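(* Let $p$ be a prime and let $\mathbf{k}$ be a field of characteristic $p$. For $r\in\mathbb{Z}$ with $1\le r\le p+1$, and $\alpha,\beta\in\mathbf{k}$ with $\alpha\neq 0$, let $f_{r,\alpha,\beta}\in G_p(\mathbf{k})$ be the class of $x-\alpha x^{r+1}+\beta x^{2r+1}$. Then every nontrivial conjugacy class in the group $G_p(\mathbf{k})$ (i.e., every conjugacy class other than that of the identity) contains an element $f_{r,\alpha,\beta}$ for some such $r,\alpha,\beta$, and each such $f_{r,\alpha,\beta}$ lies in a nontrivial conjugacy class. The integer $r$ and the element $\alpha$ are uniquely determined by the conjugacy class. If $r\le\frac{p+1}{2}$, then $\beta$ is also uniquely determined by the conjugacy class; if $r>\frac{p+1}{2}$, then the conjugacy class of $f_{r,\alpha,\beta}$ is independent of $\beta$.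
   Context: For a field $\mathbf{k}$, $G(\mathbf{k})$ denotes the group of formal changes of variable, i.e., of formal power series $f(x)=x+a_2x^2+a_3x^3+\cdots$ with $a_j\in\mathbf{k}$, with group operation the composition $(f\circ h)(x)=f(h(x))$ and identity element $x$. If $\mathbf{k}$ has characteristic $p>0$, let $H_p(\mathbf{k})\subset G(\mathbf{k})$ be the normal subgroup of all $f\in G(\mathbf{k})$ with $f(x)=x+O(x^{p+3})$ (i.e., $a_j=0$ for $2\le j\le p+2$), and set $G_p(\mathbf{k})=G(\mathbf{k})/H_p(\mathbf{k})$. Thus $G_p(\mathbf{k})$ consists of polynomials $f(x)=x+a_2x^2+\cdots+a_{p+2}x^{p+2}$ with $a_i\in\mathbf{k}$, under composition modulo terms $x^j$ with $j\ge p+3$. In particular, in $x-\alpha x^{r+1}+\beta x^{2r+1}$ any term of degree at least $p+3$ is discarded. *)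

theory Defs
  imports
    "HOL-Algebra.Coset"
    "HOL-Computational_Algebra.Computational_Algebra"
begin

unbundle fps_syntax

definition change_group :: "'a::field fps monoid" where
  "change_group = \<lparr>carrier = {f. f $ 0 = 0 \<and> f $ 1 = 1}, monoid.mult = (\<lambda>f h. f oo h), one = fps_X\<rparr>"

definition change_subgroup :: "nat \<Rightarrow> 'a::field fps set" where
  "change_subgroup p = {f \<in> carrier change_group. \<forall>j. 2 \<le> j \<and> j \<le> p + 2 \<longrightarrow> f $ j = 0}"

definition change_quotient :: "nat \<Rightarrow> 'a::field fps set monoid" where
  "change_quotient p = change_group Mod change_subgroup p"

definition conjugacy_class :: "('b, 'm) monoid_scheme \<Rightarrow> 'b \<Rightarrow> 'b set" where
  "conjugacy_class G x = {g \<otimes>\<^bsub>G\<^esub> x \<otimes>\<^bsub>G\<^esub> inv\<^bsub>G\<^esub> g | g. g \<in> carrier G}"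

definition conjugacy_classes :: "('b, 'm) monoid_scheme \<Rightarrow> 'b set set" where
  "conjugacy_classes G = conjugacy_class G ` carrier G"

definition normal_form :: "nat \<Rightarrow> nat \<Rightarrow> 'a \<Rightarrow> 'a \<Rightarrow> 'a::field fps set" where
  "normal_form p r \<alpha> \<beta> = change_subgroup p #>\<^bsub>change_group\<^esub>
     (fps_X - fps_const \<alpha> * fps_X ^ (r + 1) + fps_const \<beta> * fps_X ^ (2 * r + 1))"

text \<open>
  The quotient above is formed from a group and a normal subgroup, and the normal forms are
  elements of it.
\<close>

lemma group_change_group: "group (change_group :: 'a::field fps monoid)"
proof (rule groupI)
  fix f :: "'a fps" assume f: "f \<in> carrier change_group"
  have "fps_inv f $ 1 = 1" using f by (simp add: change_group_def fps_inv_def)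
  moreover have "fps_inv f oo f = fps_X" using f by (intro fps_inv) (auto simp: change_group_def)
  ultimately show "\<exists>g\<in>carrier change_group. g \<otimes>\<^bsub>change_group\<^esub> f = \<one>\<^bsub>change_group\<^esub>"
    by (intro bexI[of _ "fps_inv f"]) (auto simp: change_group_def fps_inv_def)
qed (auto simp: change_group_def fps_compose_nth fps_compose_assoc fps_X_fps_compose_startby0)

lemma fps_compose_cong_below:
  fixes f f' h h' :: "'a::field fps"
  assumes "\<And>n. n < N \<Longrightarrow> f $ n = f' $ n" "\<And>n. n < N \<Longrightarrow> h $ n = h' $ n" and n: "n < N"
  shows "(f oo h) $ n = (f' oo h') $ n"
proof -
  have "(h ^ i) $ m = (h' ^ i) $ m" if "m < N" for i m
    using that assms(2) by (induction i arbitrary: m) (auto simp: fps_mult_nth intro!: sum.cong)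
  then show ?thesis
    using assms(1) n by (auto simp: fps_compose_nth intro!: sum.cong)
qed

lemma change_subgroup_iff:
  "f \<in> change_subgroup p \<longleftrightarrow> (\<forall>n<p + 3. f $ n = (fps_X :: 'a::field fps) $ n)"
proof -
  have "n = 0 \<or> n = 1 \<or> (2 \<le> n \<and> n \<le> p + 2)" if "n < p + 3" for n using that by linarith
  then show ?thesis
    by (fastforce simp: change_subgroup_def change_group_def fps_X_def)
qed

lemma change_subgroup_normal: "change_subgroup p \<lhd> (change_group :: 'a::field fps monoid)"
proof -
  let ?G = "change_group :: 'a fps monoid"
  interpret group ?G by (rule group_change_group)
  have X: "\<one>\<^bsub>?G\<^esub> = fps_X" by (simp add: change_group_def)
  have H: "f \<in> change_subgroup p \<longleftrightarrow> (\<forall>n<p + 3. f $ n = \<one>\<^bsub>?G\<^esub> $ n)" for f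
    unfolding X by (rule change_subgroup_iff)
  have sub: "change_subgroup p \<subseteq> carrier ?G" by (auto simp: change_subgroup_def)
  have cong: "(f \<otimes>\<^bsub>?G\<^esub> h) $ n = (f' \<otimes>\<^bsub>?G\<^esub> h') $ n"
    if "\<forall>n<p + 3. f $ n = f' $ n" "\<forall>n<p + 3. h $ n = h' $ n" "n < p + 3" for f f' h h' n
    using fps_compose_cong_below[of "p + 3" f f' h h' n] that by (simp add: change_group_def)
  have 1: "f \<otimes>\<^bsub>?G\<^esub> h \<in> change_subgroup p"
    if "f \<in> change_subgroup p" "h \<in> change_subgroup p" for f h
    using cong[of f "\<one>\<^bsub>?G\<^esub>" h "\<one>\<^bsub>?G\<^esub>"] that unfolding H by simp
  have 2: "inv\<^bsub>?G\<^esub> f \<in> change_subgroup p" if f: "f \<in> change_subgroup p" for f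
  proof -
    have "f \<in> carrier ?G" using f sub by auto
    then show ?thesis
      using cong[of f "\<one>\<^bsub>?G\<^esub>" "inv\<^bsub>?G\<^esub> f" "inv\<^bsub>?G\<^esub> f"] f unfolding H by simp
  qed
  have 3: "x \<otimes>\<^bsub>?G\<^esub> f \<otimes>\<^bsub>?G\<^esub> inv\<^bsub>?G\<^esub> x \<in> change_subgroup p"
    if f: "f \<in> change_subgroup p" and x: "x \<in> carrier ?G" for f x
  proof -
    have "\<forall>n<p + 3. (x \<otimes>\<^bsub>?G\<^esub> f) $ n = x $ n"
      using cong[of x x f "\<one>\<^bsub>?G\<^esub>"] f x unfolding H by simp
    then show ?thesis
      using cong[of "x \<otimes>\<^bsub>?G\<^esub> f" x "inv\<^bsub>?G\<^esub> x" "inv\<^bsub>?G\<^esub> x"] x unfolding H by simp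
  qed
  have "subgroup (change_subgroup p) ?G"
    using sub 1 2 H by (intro subgroupI) auto
  then show ?thesis using 3 by (auto simp: normal_inv_iff)
qed

lemma group_change_quotient: "group (change_quotient p :: 'a::field fps set monoid)"
  unfolding change_quotient_def by (rule normal.factorgroup_is_group[OF change_subgroup_normal])

lemma normal_form_carrier:
  assumes "1 \<le> r"
  shows "normal_form p r \<alpha> \<beta> \<in> carrier (change_quotient p)"
  using assms
  by (auto simp: normal_form_def change_quotient_def carrier_FactGroup change_group_def
      intro!: imageI)

end

theory Submission
  imports Defs
begin

text \<open>
  Write \<open>g = x + u\<close>, \<open>f = x + d\<close> with leading terms \<open>u = c x\<^sup>s\<^sup>+\<^sup>1 + \<dots>\<close> and \<open>d = a x\<^sup>r\<^sup>+\<^sup>1 + \<dots>\<close>.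
  Modulo \<open>x\<^sup>r\<^sup>+\<^sup>s\<^sup>+\<^sup>2\<close> conjugation of \<open>f\<close> by \<open>g\<close> only adds \<open>(s - r) a c x\<^sup>r\<^sup>+\<^sup>s\<^sup>+\<^sup>1\<close>.
  In the range \<open>r + s \<le> p + 1\<close> the factor \<open>s - r\<close> vanishes in characteristic \<open>p\<close> only for \<open>s = r\<close>,
  so every coefficient of \<open>f\<close> beyond the leading one can be removed except the one at \<open>x\<^sup>2\<^sup>r\<^sup>+\<^sup>1\<close>.
  Conversely, if \<open>g\<close> conjugates one normal form into another, then all terms of \<open>u\<close> of degree
  at most \<open>r\<close> must vanish, and the term of degree \<open>r + 1\<close> leaves the coefficient
  at \<open>x\<^sup>2\<^sup>r\<^sup>+\<^sup>1\<close> unchanged.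
\<close>

section \<open>Conjugacy in an abstract group, in a form free of inverses\<close>

lemma (in group) mem_conjugacy_class_iff:
  assumes "x \<in> carrier G" "y \<in> carrier G"
  shows "y \<in> conjugacy_class G x \<longleftrightarrow> (\<exists>g\<in>carrier G. g \<otimes> x = y \<otimes> g)"
proof -
  have "y = g \<otimes> x \<otimes> inv g \<longleftrightarrow> g \<otimes> x = y \<otimes> g" if "g \<in> carrier G" for g
    using assms that inv_solve_right[of y "g \<otimes> x" g] by auto
  then show ?thesis by (auto simp: conjugacy_class_def)
qed

lemma (in group) conjugacy_class_self:
  assumes "x \<in> carrier G"
  shows "x \<in> conjugacy_class G x"
  using assms by (auto simp: mem_conjugacy_class_iff intro!: bexI[of _ \<one>])

lemma (in group) conjugacy_class_one: "conjugacy_class G \<one> = {\<one>}"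
  by (auto simp: conjugacy_class_def intro: exI[of _ \<one>])

lemma (in group) conjugacy_class_conjugate:
  assumes "x \<in> carrier G" "y \<in> conjugacy_class G x" "z \<in> conjugacy_class G x"
  shows "\<exists>g\<in>carrier G. g \<otimes> y = z \<otimes> g"
proof -
  obtain a b where ab: "a \<in> carrier G" "b \<in> carrier G"
    "y = a \<otimes> x \<otimes> inv a" "z = b \<otimes> x \<otimes> inv b"
    using assms by (auto simp: conjugacy_class_def)
  \<comment> \<open>Going back from \<open>y\<close> to \<open>x\<close> with \<open>inv a\<close>
    and on to \<open>z\<close> with \<open>b\<close> gives the conjugator.\<close>
  have "(b \<otimes> inv a) \<otimes> y = b \<otimes> x \<otimes> inv a"
    using ab assms(1) by (simp add: m_assoc inv_solve_left')
  moreover have "z \<otimes> (b \<otimes> inv a) = b \<otimes> x \<otimes> inv a"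
    using ab assms(1) by (simp add: m_assoc inv_solve_left')
  ultimately show ?thesis
    using ab by (intro bexI[of _ "b \<otimes> inv a"]) auto
qed

section \<open>The quotient as truncation of series modulo \<open>x^(p+3)\<close>\<close>

lemma carrier_change_group: "f \<in> carrier change_group \<longleftrightarrow> f $ 0 = 0 \<and> f $ 1 = 1"
  by (simp add: change_group_def)

lemma mult_change_group: "f \<otimes>\<^bsub>change_group\<^esub> h = f oo h"
  by (simp add: change_group_def)

lemma one_change_group: "\<one>\<^bsub>change_group\<^esub> = fps_X"
  by (simp add: change_group_def)

text \<open>Elements of the coset of \<open>h\<close> are \<open>k oo h\<close> with
  \<open>k\<close> equal to \<open>x\<close> below degree \<open>p + 3\<close>, and composition
  respects agreement below a fixed degree. Conversely, \<open>f oo h^(-1)\<close> serves as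
  \<open>k\<close>.\<close>

lemma change_subgroup_coset_eq_iff:
  fixes f h :: "'a::field fps"
  assumes f: "f \<in> carrier change_group" and h: "h \<in> carrier change_group"
  shows "change_subgroup p #>\<^bsub>change_group\<^esub> f = change_subgroup p #>\<^bsub>change_group\<^esub> h \<longleftrightarrow>
    (\<forall>n<p + 3. f $ n = h $ n)"
proof -
  let ?G = "change_group :: 'a fps monoid" and ?H = "change_subgroup p :: 'a fps set"
  interpret normal ?H ?G by (rule change_subgroup_normal)
  have "?H #>\<^bsub>?G\<^esub> f = ?H #>\<^bsub>?G\<^esub> h \<longleftrightarrow> f \<in> ?H #>\<^bsub>?G\<^esub> h"
    using f h rcos_self[OF f] repr_independence[of f ?H h] subgroup_axioms by metis
  also have "\<dots> \<longleftrightarrow> (\<exists>k\<in>?H. f = k oo h)"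
    by (auto simp: r_coset_def mult_change_group)
  also have "\<dots> \<longleftrightarrow> (\<forall>n<p + 3. f $ n = h $ n)"
  proof
    assume "\<exists>k\<in>?H. f = k oo h"
    then obtain k where k: "k \<in> ?H" "f = k oo h" by blast
    show "\<forall>n<p + 3. f $ n = h $ n"
      using fps_compose_cong_below[of "p + 3" k fps_X h h] k h
      by (simp add: change_subgroup_iff fps_X_fps_compose_startby0 carrier_change_group)
  next
    assume eq: "\<forall>n<p + 3. f $ n = h $ n"
    define k where "k = f \<otimes>\<^bsub>?G\<^esub> inv\<^bsub>?G\<^esub> h"
    have "k $ n = fps_X $ n" if "n < p + 3" for n
      using fps_compose_cong_below[of "p + 3" f h "inv\<^bsub>?G\<^esub> h" "inv\<^bsub>?G\<^esub> h" n] eq h that r_inv[OF h]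
      unfolding k_def mult_change_group one_change_group by simp
    moreover have "f = k \<otimes>\<^bsub>?G\<^esub> h"
      unfolding k_def using f h by (simp add: m_assoc)
    ultimately show "\<exists>k\<in>?H. f = k oo h"
      by (auto simp: change_subgroup_iff mult_change_group)
  qed
  finally show ?thesis .
qed

text \<open>This moves conjugacy from cosets to coefficients, so that the main computations can be
  done with series alone.\<close>

lemma change_quotient_conj_iff:
  fixes f g h :: "'a::field fps" and p :: nat
  assumes "f \<in> carrier change_group" "g \<in> carrier change_group" "h \<in> carrier change_group"
  defines "q \<equiv> r_coset change_group (change_subgroup p)"
  shows "q g \<otimes>\<^bsub>change_quotient p\<^esub> q f = q h \<otimes>\<^bsub>change_quotient p\<^esub> q g \<longleftrightarrow>
    (\<forall>n<p + 3. (g oo f) $ n = (h oo g) $ n)"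
proof -
  let ?G = "change_group :: 'a fps monoid" and ?H = "change_subgroup p :: 'a fps set"
  interpret normal ?H ?G by (rule change_subgroup_normal)
  have "q g \<otimes>\<^bsub>change_quotient p\<^esub> q f = q (g \<otimes>\<^bsub>?G\<^esub> f)"
    "q h \<otimes>\<^bsub>change_quotient p\<^esub> q g = q (h \<otimes>\<^bsub>?G\<^esub> g)"
    unfolding change_quotient_def mult_FactGroup q_def using assms(1-3) by (simp_all add: rcos_sum)
  then show ?thesis
    unfolding q_def using change_subgroup_coset_eq_iff[of "g \<otimes>\<^bsub>?G\<^esub> f" "h \<otimes>\<^bsub>?G\<^esub> g" p] assms(1-3)
    by (simp add: mult_change_group[symmetric])
qed

lemma carrier_change_quotient:
  "carrier (change_quotient p) =
    r_coset change_group (change_subgroup p) ` (carrier change_group :: 'a::field fps set)"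
  by (simp add: change_quotient_def carrier_FactGroup)

section \<open>First-order expansion of compositions\<close>

text \<open>In \<open>(x + d)^i = x^i + i x^(i-1) d + ...\<close> the linear term starts in degree
  \<open>i + m\<close>, while terms with at least two factors \<open>d\<close> start in degree
  \<open>i + 2m\<close> or later, out of range since \<open>m\<close> is positive.\<close>

lemma fps_X_add_power_nth:
  fixes d :: "'a::comm_ring_1 fps"
  assumes d: "\<And>n. n \<le> m \<Longrightarrow> d $ n = 0" and m: "1 \<le> m" and n: "n \<le> i + m"
  shows "((fps_X + d) ^ i) $ n =
    (if n = i then 1 else 0) + (if n = i + m then of_nat i * d $ (m + 1) else 0)"
  using n
proof (induction i arbitrary: n)
  case 0
  then show ?case by simp
next
  case (Suc i)
  let ?f = "fps_X + d"
  \<comment> \<open>Up to degree \<open>Suc i + m\<close> only the lowest term of \<open>d\<close>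
    times the leading term \<open>x^i\<close> of \<open>?f ^ i\<close> can contribute.\<close>
  have *: "(d * ?f ^ i) $ n = (if n = Suc i + m then d $ (m + 1) else 0)"
  proof -
    have "(d * ?f ^ i) $ n = (\<Sum>k\<in>{0..n}. d $ k * (?f ^ i) $ (n - k))"
      by (simp add: fps_mult_nth)
    also have "\<dots> = (\<Sum>k\<in>{0..n}. if k = m + 1 then (if n = Suc i + m then d $ (m + 1) else 0) else 0)"
    proof (intro sum.cong refl)
      fix k assume k: "k \<in> {0..n}"
      consider "k \<le> m" | "k > m" "k \<noteq> m + 1" | "k = m + 1" by linarith
      then show "d $ k * (?f ^ i) $ (n - k) =
        (if k = m + 1 then (if n = Suc i + m then d $ (m + 1) else 0) else 0)"
      proof cases
        case 1
        then show ?thesis using d by auto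
      next
        case 2
        then have "n - k \<le> i + m" "n - k \<noteq> i" "n - k \<noteq> i + m" using Suc.prems k m by auto
        then show ?thesis using 2 Suc.IH[of "n - k"] by simp
      next
        case 3
        then have "n - k \<le> i + m" "n - k \<noteq> i + m" "n - k = i \<longleftrightarrow> n = Suc i + m"
          using Suc.prems k m by auto
        then show ?thesis using 3 Suc.IH[of "n - k"] by simp
      qed
    qed
    also have "\<dots> = (if n = Suc i + m then d $ (m + 1) else 0)"
      using m by auto
    finally show ?thesis .
  qed
  show ?case
  proof (cases n)
    case 0
    then show ?thesis using * d m by (simp add: distrib_right)
  next
    case (Suc n')
    then have "n' \<le> i + m" using Suc.prems by simp
    then show ?thesis using * Suc Suc.IH[of n'] by (auto simp: algebra_simps)
  qed
qed

text \<open>The first-order Taylor expansion of \<open>u(x + d)\<close>, cut off after its first correction term.\<close>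

lemma fps_compose_X_add_nth:
  fixes u d :: "'a::comm_ring_1 fps"
  assumes u: "\<And>n. n \<le> s \<Longrightarrow> u $ n = 0" and d: "\<And>n. n \<le> m \<Longrightarrow> d $ n = 0"
    and m: "1 \<le> m" and n: "n \<le> s + m + 1"
  shows "(u oo (fps_X + d)) $ n =
    u $ n + (if n = s + m + 1 then of_nat (s + 1) * u $ (s + 1) * d $ (m + 1) else 0)"
proof -
  let ?e = "if n = s + m + 1 then of_nat (s + 1) * u $ (s + 1) * d $ (m + 1) else 0"
  have "(u oo (fps_X + d)) $ n = (\<Sum>i\<in>{0..n}. u $ i * ((fps_X + d) ^ i) $ n)"
    by (simp add: fps_compose_nth)
  also have "\<dots> = (\<Sum>i\<in>{0..n}. (if i = n then u $ n else 0) + (if i = s + 1 then ?e else 0))"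
  proof (intro sum.cong refl)
    fix i assume i: "i \<in> {0..n}"
    show "u $ i * ((fps_X + d) ^ i) $ n = (if i = n then u $ n else 0) + (if i = s + 1 then ?e else 0)"
    proof (cases "i \<le> s")
      case True
      then show ?thesis using u by auto
    next
      case False
      \<comment> \<open>The bound on \<open>n\<close> is exactly what keeps every power with
        \<open>i > s\<close> in the range of the power expansion; its correction is visible only for
        \<open>i = s + 1\<close>.\<close>
      then have "n \<le> i + m" "n = i + m \<longleftrightarrow> n = s + m + 1 \<and> i = s + 1" using n by auto
      then show ?thesis
        using fps_X_add_power_nth[OF d m, of n i] by (auto simp: algebra_simps)
    qed
  qed
  also have "\<dots> = u $ n + ?e"
    by (auto simp: sum.distrib)
  finally show ?thesis .
qed

text \<open>Write \<open>g oo f = f + (g - x) oo f\<close> and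
  \<open>h oo g = g + (h - x) oo g\<close> and expand both: the terms \<open>g - x\<close> cancel.
  When \<open>f\<close> and \<open>h\<close> share the leading coefficient \<open>a\<close> in
  degree \<open>m + 1\<close>, the correction is \<open>(s - m) a\<close> times the coefficient of
  \<open>g\<close> in degree \<open>s + 1\<close>.\<close>

lemma fps_compose_conj_nth:
  fixes f g h :: "'a::comm_ring_1 fps"
  assumes g: "\<And>n. n \<le> s \<Longrightarrow> g $ n = fps_X $ n" and f: "\<And>n. n \<le> m \<Longrightarrow> f $ n = fps_X $ n"
    and h: "\<And>n. n \<le> m \<Longrightarrow> h $ n = fps_X $ n"
    and s: "1 \<le> s" and m: "1 \<le> m" and n: "n \<le> s + m + 1"
  shows "(g oo f) $ n - (h oo g) $ n = f $ n - h $ n +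
    (if n = s + m + 1
     then of_nat (s + 1) * g $ (s + 1) * f $ (m + 1) - of_nat (m + 1) * h $ (m + 1) * g $ (s + 1)
     else 0)"
proof -
  have f0: "f $ 0 = 0" and g0: "g $ 0 = 0" using f[of 0] g[of 0] by auto
  have "((g - fps_X) oo (fps_X + (f - fps_X))) $ n = (g - fps_X) $ n +
    (if n = s + m + 1 then of_nat (s + 1) * (g - fps_X) $ (s + 1) * (f - fps_X) $ (m + 1) else 0)"
    using f g m n by (intro fps_compose_X_add_nth) auto
  then have gf: "(g oo f) $ n = f $ n + (g $ n - fps_X $ n +
    (if n = s + m + 1 then of_nat (s + 1) * g $ (s + 1) * f $ (m + 1) else 0))"
    using s m f0 by (simp add: fps_compose_sub_distrib fps_X_fps_compose_startby0 diff_eq_eq add.commute)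
  have "((h - fps_X) oo (fps_X + (g - fps_X))) $ n = (h - fps_X) $ n +
    (if n = m + s + 1 then of_nat (m + 1) * (h - fps_X) $ (m + 1) * (g - fps_X) $ (s + 1) else 0)"
    using h g s n by (intro fps_compose_X_add_nth) auto
  then have hg: "(h oo g) $ n = g $ n + (h $ n - fps_X $ n +
    (if n = s + m + 1 then of_nat (m + 1) * h $ (m + 1) * g $ (s + 1) else 0))"
    using s m g0 by (simp add: fps_compose_sub_distrib fps_X_fps_compose_startby0 diff_eq_eq add.commute)
  show ?thesis
    unfolding gf hg by simp
qed

section \<open>Representatives of the normal forms, and indices modulo the characteristic\<close>

text \<open>The untruncated representative of \<open>normal_form\<close>. Its last term may exceed
  degree \<open>p + 2\<close>, which is harmless because comparisons stop below
  \<open>p + 3\<close>.\<close>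

definition normal_series :: "nat \<Rightarrow> 'a \<Rightarrow> 'a \<Rightarrow> 'a::field fps" where
  "normal_series r \<alpha> \<beta> = fps_X - fps_const \<alpha> * fps_X ^ (r + 1) + fps_const \<beta> * fps_X ^ (2 * r + 1)"

lemma normal_series_nth:
  assumes "1 \<le> r"
  shows "normal_series r \<alpha> \<beta> $ n =
    (if n = 1 then 1 else if n = r + 1 then - \<alpha> else if n = 2 * r + 1 then \<beta> else 0)"
  using assms unfolding normal_series_def by (auto simp: fps_X_power_nth)

lemma normal_series_carrier:
  assumes "1 \<le> r"
  shows "normal_series r \<alpha> \<beta> \<in> carrier change_group"
  using assms by (auto simp: carrier_change_group normal_series_nth)

lemma normal_form_eq:
  "normal_form p r \<alpha> \<beta> = change_subgroup p #>\<^bsub>change_group\<^esub> normal_series r \<alpha> \<beta>"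
  by (simp add: normal_form_def normal_series_def)

text \<open>A positive difference smaller than the characteristic is not divisible by it. This
  applies to distinct positive \<open>r\<close>, \<open>s\<close> with
  \<open>r + s <= p + 1\<close>, which differ by less than \<open>p\<close>.\<close>

lemma of_nat_neq_of_nat_CHAR:
  assumes "r \<noteq> s" "r < s + CHAR('a::ring_1)" "s < r + CHAR('a)"
  shows "(of_nat r :: 'a) \<noteq> of_nat s"
proof -
  have *: "(of_nat a :: 'a) \<noteq> of_nat b" if "b < a" "a < b + CHAR('a)" for a b
  proof
    assume "(of_nat a :: 'a) = of_nat b"
    then have "(of_nat (a - b) :: 'a) = 0" using that by (simp add: of_nat_diff)
    then have "CHAR('a) dvd a - b" by (simp add: of_nat_eq_0_iff_char_dvd)
    then show False using that by (auto dest: dvd_imp_le)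
  qed
  show ?thesis using *[of r s] *[of s r] assms by (cases "r < s") auto
qed

section \<open>Invariants of a conjugacy class\<close>

text \<open>Every \<open>g\<close> in the group is \<open>x + O(x^2)\<close>, so the expansion with
  \<open>s = 1\<close> applies, and its correction first appears in degree
  \<open>m + 2\<close>.\<close>

lemma conj_leading_coeff_eq:
  fixes f g h :: "'a::field fps"
  assumes g: "g \<in> carrier change_group"
    and f: "\<And>n. n \<le> m \<Longrightarrow> f $ n = fps_X $ n" and h: "\<And>n. n \<le> m \<Longrightarrow> h $ n = fps_X $ n"
    and m: "1 \<le> m" and eq: "(g oo f) $ (m + 1) = (h oo g) $ (m + 1)"
  shows "f $ (m + 1) = h $ (m + 1)"
proof -
  have "g $ n = fps_X $ n" if "n \<le> 1" for n
    using that g by (cases n) (auto simp: carrier_change_group)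
  from fps_compose_conj_nth[of 1 g m f h "m + 1", OF this f h _ m] show ?thesis using eq by simp
qed

lemma normal_series_conj_leading:
  fixes \<alpha> \<alpha>' :: "'a::field"
  assumes g: "g \<in> carrier change_group"
    and eq: "\<And>n. n < p + 3 \<Longrightarrow> (g oo normal_series r \<alpha> \<beta>) $ n = (normal_series r' \<alpha>' \<beta>' oo g) $ n"
    and r: "1 \<le> r" "r \<le> p + 1" "1 \<le> r'" "r' \<le> p + 1" and \<alpha>: "\<alpha> \<noteq> 0" "\<alpha>' \<noteq> 0"
  shows "r = r' \<and> \<alpha> = \<alpha>'"
proof -
  \<comment> \<open>With \<open>m\<close> the smaller of \<open>r\<close> and \<open>r'\<close>,
    distinct exponents would make one coefficient in degree \<open>m + 1\<close> zero and the other
    nonzero.\<close>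
  obtain m where m: "m \<le> r" "m \<le> r'" "m = r \<or> m = r'" by (metis linear)
  have "normal_series r \<alpha> \<beta> $ n = fps_X $ n" "normal_series r' \<alpha>' \<beta>' $ n = fps_X $ n"
    if "n \<le> m" for n
    using that m r by (simp_all add: normal_series_nth)
  then have lead: "normal_series r \<alpha> \<beta> $ (m + 1) = normal_series r' \<alpha>' \<beta>' $ (m + 1)"
    by (rule conj_leading_coeff_eq[OF g]) (use m r eq in auto)
  from m(3) show ?thesis
  proof
    assume "m = r"
    then show ?thesis
      using lead m(2) r \<alpha> by (cases "r = r'") (simp_all add: normal_series_nth)
  next
    assume "m = r'"
    then show ?thesis
      using lead m(1) r \<alpha> by (cases "r = r'") (simp_all add: normal_series_nth)
  qed
qed

lemma normal_series_conj_second: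
  fixes \<alpha> :: "'a::field"
  assumes char: "CHAR('a) = p" and g: "g \<in> carrier change_group"
    and eq: "\<And>n. n < p + 3 \<Longrightarrow> (g oo normal_series r \<alpha> \<beta>) $ n = (normal_series r \<alpha> \<beta>' oo g) $ n"
    and r: "1 \<le> r" "2 * r \<le> p + 1" and \<alpha>: "\<alpha> \<noteq> 0"
  shows "\<beta> = \<beta>'"
proof -
  let ?f = "normal_series r \<alpha> \<beta>" and ?h = "normal_series r \<alpha> \<beta>'"
  have conj: "0 = ?f $ (s + r + 1) - ?h $ (s + r + 1) +
      (of_nat r - of_nat s) * (\<alpha> * g $ (s + 1))"
    if "1 \<le> s" "s \<le> r" "\<And>n. n \<le> s \<Longrightarrow> g $ n = fps_X $ n" for s
  proof -
    have "(g oo ?f) $ (s + r + 1) = (?h oo g) $ (s + r + 1)"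
      \<comment> \<open>The degree is at most \<open>2 * r + 1 <= p + 2\<close>, hence not lost by
        truncation.\<close>
      using that r by (intro eq) auto
    moreover have "(g oo ?f) $ (s + r + 1) - (?h oo g) $ (s + r + 1) =
        ?f $ (s + r + 1) - ?h $ (s + r + 1) +
        (if s + r + 1 = s + r + 1
         then of_nat (s + 1) * g $ (s + 1) * ?f $ (r + 1) - of_nat (r + 1) * ?h $ (r + 1) * g $ (s + 1)
         else 0)"
      using that r by (intro fps_compose_conj_nth) (auto simp: normal_series_nth)
    ultimately show ?thesis
      using r by (simp add: normal_series_nth algebra_simps)
  qed
  have g_low: "\<forall>n\<le>s. g $ n = fps_X $ n" if "1 \<le> s" "s \<le> r" for s
    using that
  proof (induction s rule: dec_induct)
    case base
    have "n = 0 \<or> n = 1" if "n \<le> 1" for n :: nat using that by linarith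
    then show ?case using g by (auto simp: carrier_change_group)
  next
    case (step s)
    \<comment> \<open>The degree lies strictly between \<open>r + 1\<close> and
      \<open>2 * r + 1\<close>, where both series have coefficient zero.\<close>
    have "?f $ (s + r + 1) = ?h $ (s + r + 1)"
      using step by (simp add: normal_series_nth)
    then have "(of_nat r - of_nat s) * (\<alpha> * g $ (s + 1)) = 0"
      using conj[of s] step by simp
    moreover have "(of_nat r :: 'a) \<noteq> of_nat s"
      using step r char by (intro of_nat_neq_of_nat_CHAR) auto
    ultimately have "g $ (s + 1) = 0" using \<alpha> by simp
    then show ?case using step by (auto simp: le_Suc_eq)
  qed
  \<comment> \<open>At \<open>s = r\<close> the factor \<open>r - s\<close> kills the unknown
    coefficient of \<open>g\<close>, leaving only \<beta> - \<beta>'.\<close>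
  show ?thesis using conj[of r] g_low[of r] r by (simp add: normal_series_nth)
qed

section \<open>Reduction to normal form\<close>

lemma conj_adjust_coeff:
  fixes h k :: "'a::field fps"
  assumes h: "\<And>n. n \<le> m \<Longrightarrow> h $ n = fps_X $ n" and k: "\<And>n. n \<le> m + s \<Longrightarrow> k $ n = h $ n"
    and ms: "1 \<le> m" "1 \<le> s" and lead: "h $ (m + 1) \<noteq> 0" and neq: "(of_nat m :: 'a) \<noteq> of_nat s"
  shows "\<exists>g\<in>carrier change_group. \<forall>n<m + s + 2. (g oo h) $ n = (k oo g) $ n"
proof -
  \<comment> \<open>Conjugation by \<open>x + c x^(s+1)\<close> changes the coefficient in degree
    \<open>m + s + 1\<close> by \<open>(s - m) c\<close> times the leading one; \<open>c\<close> is
    the solution that produces the coefficient of \<open>k\<close>.\<close>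
  define c where "c = (k $ (m + s + 1) - h $ (m + s + 1)) / ((of_nat s - of_nat m) * h $ (m + 1))"
  define g where "g = fps_X + fps_const c * fps_X ^ (s + 1)"
  have g_nth: "g $ n = (if n = 1 then 1 else if n = s + 1 then c else 0)" for n
    using ms by (auto simp: g_def fps_X_power_nth)
  have "(g oo h) $ n = (k oo g) $ n" if n: "n < m + s + 2" for n
  proof -
    have "(g oo h) $ n - (k oo g) $ n = h $ n - k $ n +
      (if n = s + m + 1
       then of_nat (s + 1) * g $ (s + 1) * h $ (m + 1) - of_nat (m + 1) * k $ (m + 1) * g $ (s + 1)
       else 0)"
      using ms n h k by (intro fps_compose_conj_nth) (auto simp: g_nth)
    also have "\<dots> = 0"
    proof (cases "n = s + m + 1")
      case True
      have "k $ (m + 1) = h $ (m + 1)" using k ms by simp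
      moreover have "(of_nat s - of_nat m) * h $ (m + 1) * c = k $ (m + s + 1) - h $ (m + s + 1)"
        using lead neq by (simp add: c_def)
      ultimately show ?thesis
        using True ms by (simp add: g_nth algebra_simps)
    next
      case False
      then show ?thesis using k n by simp
    qed
    finally show ?thesis by simp
  qed
  moreover have "g \<in> carrier change_group" using ms by (simp add: carrier_change_group g_nth)
  ultimately show ?thesis by blast
qed

text \<open>Induction on \<open>s\<close> corrects one further coefficient at a time. The value
  \<beta> stays existential because it is fixed only when degree \<open>2 * r + 1\<close> is
  reached.\<close>

lemma conj_to_normal_series:
  fixes f :: "'a::field fps"
  assumes char: "CHAR('a) = p"
    and f: "\<And>n. n \<le> r \<Longrightarrow> f $ n = fps_X $ n" and lead: "f $ (r + 1) = - \<alpha>"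
    and r: "1 \<le> r" and \<alpha>: "\<alpha> \<noteq> 0" and s: "r + s \<le> p + 1"
  shows "\<exists>g\<in>carrier change_group. \<exists>\<beta>. \<forall>n<r + s + 2. (g oo f) $ n = (normal_series r \<alpha> \<beta> oo g) $ n"
  using s
proof (induction s)
  case 0
  have "f $ n = normal_series r \<alpha> 0 $ n" if "n < r + 2" for n
  proof (cases "n \<le> r")
    case True
    then show ?thesis using f r by (simp add: normal_series_nth)
  next
    case False
    then have "n = r + 1" using that by simp
    then show ?thesis using lead r by (simp add: normal_series_nth)
  qed
  then show ?case
    using f[of 0] by (intro bexI[of _ fps_X] exI[of _ 0])
      (auto simp: carrier_change_group fps_X_fps_compose_startby0)
next
  case (Suc s)
  let ?G = "change_group :: 'a fps monoid" and ?N = "normal_series r \<alpha> :: 'a \<Rightarrow> 'a fps"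
  interpret group ?G by (rule group_change_group)
  have fG: "f \<in> carrier ?G" using f[of 0] f[of 1] r by (simp add: carrier_change_group)
  obtain g \<beta> where g: "g \<in> carrier ?G"
    and eq: "\<And>n. n < r + s + 2 \<Longrightarrow> (g oo f) $ n = (?N \<beta> oo g) $ n"
    using Suc by auto
  define h where "h = g \<otimes>\<^bsub>?G\<^esub> f \<otimes>\<^bsub>?G\<^esub> inv\<^bsub>?G\<^esub> g"
  have hG: "h \<in> carrier ?G" and hg: "h \<otimes>\<^bsub>?G\<^esub> g = g \<otimes>\<^bsub>?G\<^esub> f"
    using g fG by (simp_all add: h_def m_assoc)
  have h: "h $ n = ?N \<beta> $ n" if "n < r + s + 2" for n
  proof -
    have "h $ n = (?N \<beta> \<otimes>\<^bsub>?G\<^esub> g \<otimes>\<^bsub>?G\<^esub> inv\<^bsub>?G\<^esub> g) $ n"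
      unfolding h_def mult_change_group
      by (rule fps_compose_cong_below[of "r + s + 2"]) (use eq that in auto)
    then show ?thesis using g normal_series_carrier[OF r, of \<alpha> \<beta>] by (simp add: m_assoc)
  qed
  have "\<exists>u\<in>carrier ?G. \<exists>\<beta>'. \<forall>n<r + Suc s + 2. (u oo h) $ n = (?N \<beta>' oo u) $ n"
  proof (cases "r = Suc s")
    case True
    \<comment> \<open>In this resonant degree no conjugation is attempted: the coefficient found
      there becomes the new \<beta>.\<close>
    have "h $ n = ?N (h $ (2 * r + 1)) $ n" if "n < r + Suc s + 2" for n
    proof (cases "n < r + s + 2")
      case True
      then show ?thesis using h[of n] \<open>r = Suc s\<close> r by (simp add: normal_series_nth)
    next
      case False
      then have "n = 2 * r + 1" using that \<open>r = Suc s\<close> by simp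
      then show ?thesis using r by (simp add: normal_series_nth)
    qed
    then show ?thesis
      using hG by (intro bexI[of _ fps_X] exI[of _ "h $ (2 * r + 1)"])
        (auto simp: carrier_change_group fps_X_fps_compose_startby0)
  next
    case False
    have "(of_nat r :: 'a) \<noteq> of_nat (Suc s)"
      using False r Suc.prems char by (intro of_nat_neq_of_nat_CHAR) auto
    then have "\<exists>u\<in>carrier ?G. \<forall>n<r + Suc s + 2. (u oo h) $ n = (?N \<beta> oo u) $ n"
      using r \<alpha> h by (intro conj_adjust_coeff) (auto simp: normal_series_nth)
    then show ?thesis by blast
  qed
  then obtain u \<beta>' where u: "u \<in> carrier ?G"
    and eq': "\<And>n. n < r + Suc s + 2 \<Longrightarrow> (u oo h) $ n = (?N \<beta>' oo u) $ n"
    by blast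
  \<comment> \<open>The conjugators multiply: \<open>u g f = u h g\<close>, and this agrees with the
    normal series times \<open>u g\<close> in the required degrees.\<close>
  have "((u \<otimes>\<^bsub>?G\<^esub> g) oo f) $ n = (?N \<beta>' oo (u \<otimes>\<^bsub>?G\<^esub> g)) $ n" if "n < r + Suc s + 2" for n
  proof -
    have "(u \<otimes>\<^bsub>?G\<^esub> g) \<otimes>\<^bsub>?G\<^esub> f = (u \<otimes>\<^bsub>?G\<^esub> h) \<otimes>\<^bsub>?G\<^esub> g"
      using u g fG hG hg by (simp add: m_assoc)
    moreover have "((u \<otimes>\<^bsub>?G\<^esub> h) \<otimes>\<^bsub>?G\<^esub> g) $ n = ((?N \<beta>' \<otimes>\<^bsub>?G\<^esub> u) \<otimes>\<^bsub>?G\<^esub> g) $ n"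
      unfolding mult_change_group
      by (rule fps_compose_cong_below[of "r + Suc s + 2"]) (use eq' that in auto)
    moreover have "(?N \<beta>' \<otimes>\<^bsub>?G\<^esub> u) \<otimes>\<^bsub>?G\<^esub> g = ?N \<beta>' \<otimes>\<^bsub>?G\<^esub> (u \<otimes>\<^bsub>?G\<^esub> g)"
      using u g normal_series_carrier[OF r, of \<alpha> \<beta>'] by (simp add: m_assoc)
    ultimately show ?thesis by (simp add: mult_change_group)
  qed
  then show ?case using u g by (intro bexI[of _ "u \<otimes>\<^bsub>?G\<^esub> g"]) auto
qed

section \<open>The classification in the quotient group\<close>

theorem theorem12:
  fixes p :: nat
  assumes "prime p" and "CHAR('a::field) = p"
  defines "G \<equiv> (change_quotient p :: 'a fps set monoid)"
    and "f \<equiv> (normal_form p :: nat \<Rightarrow> 'a \<Rightarrow> 'a \<Rightarrow> 'a fps set)"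
  shows
    "(\<forall>C \<in> conjugacy_classes G. C \<noteq> conjugacy_class G \<one>\<^bsub>G\<^esub> \<longrightarrow>
        (\<exists>r \<alpha> \<beta>. 1 \<le> r \<and> r \<le> p + 1 \<and> \<alpha> \<noteq> 0 \<and> f r \<alpha> \<beta> \<in> C))
   \<and> (\<forall>r \<alpha> \<beta>. 1 \<le> r \<and> r \<le> p + 1 \<and> \<alpha> \<noteq> 0 \<longrightarrow>
        (\<exists>C \<in> conjugacy_classes G. C \<noteq> conjugacy_class G \<one>\<^bsub>G\<^esub> \<and> f r \<alpha> \<beta> \<in> C))
   \<and> (\<forall>C \<in> conjugacy_classes G. \<forall>r \<alpha> \<beta> r' \<alpha>' \<beta>'.
        1 \<le> r \<and> r \<le> p + 1 \<and> \<alpha> \<noteq> 0 \<and> f r \<alpha> \<beta> \<in> C \<and>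
        1 \<le> r' \<and> r' \<le> p + 1 \<and> \<alpha>' \<noteq> 0 \<and> f r' \<alpha>' \<beta>' \<in> C \<longrightarrow>
        r = r' \<and> \<alpha> = \<alpha>' \<and> (real r \<le> (real p + 1) / 2 \<longrightarrow> \<beta> = \<beta>'))
   \<and> (\<forall>r \<alpha> \<beta> \<beta>'. 1 \<le> r \<and> r \<le> p + 1 \<and> \<alpha> \<noteq> 0 \<and> real r > (real p + 1) / 2 \<longrightarrow>
        conjugacy_class G (f r \<alpha> \<beta>) = conjugacy_class G (f r \<alpha> \<beta>'))"
proof -
  let ?C = "change_group :: 'a fps monoid"
  define q where "q = r_coset ?C (change_subgroup p)"
  interpret C: group ?C by (rule group_change_group)
  interpret G: group G unfolding G_def by (rule group_change_quotient)
  have f_q: "f r \<alpha> \<beta> = q (normal_series r \<alpha> \<beta>)" for r \<alpha> \<beta>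
    by (simp add: f_def q_def normal_form_eq)
  have carrier_G: "carrier G = q ` carrier ?C"
    by (simp add: G_def q_def carrier_change_quotient)
  have "change_subgroup p \<subseteq> carrier ?C"
    by (auto simp: change_subgroup_def)
  then have one_G: "\<one>\<^bsub>G\<^esub> = q fps_X"
    using C.coset_mult_one[of "change_subgroup p"]
    by (simp add: G_def q_def change_quotient_def one_change_group)
  have q_eq: "q a = q b \<longleftrightarrow> (\<forall>n<p + 3. a $ n = b $ n)"
    if "a \<in> carrier ?C" "b \<in> carrier ?C" for a b
    using that by (simp add: q_def change_subgroup_coset_eq_iff)
  have X: "fps_X \<in> carrier ?C" by (simp add: carrier_change_group)
  have q_conj: "q g \<otimes>\<^bsub>G\<^esub> q a = q b \<otimes>\<^bsub>G\<^esub> q g \<longleftrightarrow> (\<forall>n<p + 3. (g oo a) $ n = (b oo g) $ n)"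
    if "a \<in> carrier ?C" "b \<in> carrier ?C" "g \<in> carrier ?C" for a b g
    using that by (simp add: q_def G_def change_quotient_conj_iff)
  have f_carrier: "f r \<alpha> \<beta> \<in> carrier G" if "1 \<le> r" for r \<alpha> \<beta>
    using that by (simp add: f_def G_def normal_form_carrier)
  \<comment> \<open>The natural-number form says that degree \<open>2 * r + 1\<close> survives
    truncation.\<close>
  have half: "real r \<le> (real p + 1) / 2 \<longleftrightarrow> 2 * r \<le> p + 1" for r
    using of_nat_le_iff[of "2 * r" "p + 1", where 'a = real] by (simp add: field_simps)

  have "\<exists>r \<alpha> \<beta>. 1 \<le> r \<and> r \<le> p + 1 \<and> \<alpha> \<noteq> 0 \<and> f r \<alpha> \<beta> \<in> conjugacy_class G (q a)"
    if a: "a \<in> carrier ?C" and nontriv: "conjugacy_class G (q a) \<noteq> conjugacy_class G \<one>\<^bsub>G\<^esub>" for a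
  proof -
    have "q a \<noteq> q fps_X" using nontriv one_G by metis
    then obtain n where n: "n < p + 3" "a $ n \<noteq> fps_X $ n"
      using q_eq[OF a X] by blast
    \<comment> \<open>\<open>m\<close> is the order of \<open>a - x\<close>, so
      \<open>r + 1 = m\<close> is the degree of the leading term.\<close>
    define m where "m = (LEAST n. a $ n \<noteq> fps_X $ n)"
    have m: "a $ m \<noteq> fps_X $ m" "m \<le> n"
      unfolding m_def by (rule LeastI[of _ n], rule n(2)) (rule Least_le, rule n(2))
    have below: "a $ i = fps_X $ i" if "i < m" for i
      using that not_less_Least unfolding m_def by blast
    define r where "r = m - 1"
    have "m \<noteq> 0" "m \<noteq> 1" using m(1) a by (metis carrier_change_group fps_X_nth zero_neq_one)+
    then have r: "m = r + 1" "1 \<le> r" "r \<le> p + 1" using m(2) n(1) by (auto simp: r_def)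
    have \<alpha>: "- (a $ (r + 1)) \<noteq> 0" using m(1) r by simp
    \<comment> \<open>Taking \<open>s = p + 1 - r\<close> exhausts the admissible range and reaches
      every coefficient the quotient sees.\<close>
    have bound: "r + (p + 1 - r) + 2 = p + 3" using r(3) by simp
    have "\<exists>g\<in>carrier ?C. \<exists>\<beta>. \<forall>n<r + (p + 1 - r) + 2.
        (g oo a) $ n = (normal_series r (- (a $ (r + 1))) \<beta> oo g) $ n"
      using below r \<alpha> by (intro conj_to_normal_series[OF assms(2)]) auto
    then obtain g \<beta> where g: "g \<in> carrier ?C"
      and "\<forall>n<p + 3. (g oo a) $ n = (normal_series r (- (a $ (r + 1))) \<beta> oo g) $ n"
      unfolding bound by blast
    then have "q g \<otimes>\<^bsub>G\<^esub> q a = f r (- (a $ (r + 1))) \<beta> \<otimes>\<^bsub>G\<^esub> q g"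
      unfolding f_q using q_conj[OF a normal_series_carrier[OF r(2)] g] by blast
    moreover have "q g \<in> carrier G" "q a \<in> carrier G" using g a carrier_G by auto
    ultimately have "f r (- (a $ (r + 1))) \<beta> \<in> conjugacy_class G (q a)"
      using G.mem_conjugacy_class_iff[of "q a"] f_carrier[OF r(2)] by blast
    then show ?thesis using r \<alpha> by blast
  qed
  then have exists: "\<forall>C \<in> conjugacy_classes G. C \<noteq> conjugacy_class G \<one>\<^bsub>G\<^esub> \<longrightarrow>
      (\<exists>r \<alpha> \<beta>. 1 \<le> r \<and> r \<le> p + 1 \<and> \<alpha> \<noteq> 0 \<and> f r \<alpha> \<beta> \<in> C)"
    unfolding conjugacy_classes_def carrier_G by blast

  have nontrivial: "\<exists>C \<in> conjugacy_classes G. C \<noteq> conjugacy_class G \<one>\<^bsub>G\<^esub> \<and> f r \<alpha> \<beta> \<in> C"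
    if r: "1 \<le> r" "r \<le> p + 1" and \<alpha>: "\<alpha> \<noteq> 0" for r \<alpha> \<beta>
  proof (intro bexI conjI)
    show self: "f r \<alpha> \<beta> \<in> conjugacy_class G (f r \<alpha> \<beta>)"
      using r by (intro G.conjugacy_class_self f_carrier)
    have "normal_series r \<alpha> \<beta> $ (r + 1) \<noteq> fps_X $ (r + 1)"
      using r \<alpha> by (simp add: normal_series_nth)
    moreover have "r + 1 < p + 3" using r by simp
    ultimately have "f r \<alpha> \<beta> \<noteq> \<one>\<^bsub>G\<^esub>"
      unfolding f_q one_G using q_eq[OF normal_series_carrier[OF r(1)] X] by blast
    then show "conjugacy_class G (f r \<alpha> \<beta>) \<noteq> conjugacy_class G \<one>\<^bsub>G\<^esub>"
      using self G.conjugacy_class_one by auto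
    show "conjugacy_class G (f r \<alpha> \<beta>) \<in> conjugacy_classes G"
      using f_carrier[OF r(1)] by (simp add: conjugacy_classes_def)
  qed

  have unique: "r = r' \<and> \<alpha> = \<alpha>' \<and> (2 * r \<le> p + 1 \<longrightarrow> \<beta> = \<beta>')"
    if C: "C \<in> conjugacy_classes G" and r: "1 \<le> r" "r \<le> p + 1" "1 \<le> r'" "r' \<le> p + 1"
      and \<alpha>: "\<alpha> \<noteq> 0" "\<alpha>' \<noteq> 0" and mem: "f r \<alpha> \<beta> \<in> C" "f r' \<alpha>' \<beta>' \<in> C" for C r \<alpha> \<beta> r' \<alpha>' \<beta>'
  proof -
    obtain x where "x \<in> carrier G" "C = conjugacy_class G x"
      using C by (auto simp: conjugacy_classes_def)
    then obtain y where "y \<in> carrier G" "y \<otimes>\<^bsub>G\<^esub> f r \<alpha> \<beta> = f r' \<alpha>' \<beta>' \<otimes>\<^bsub>G\<^esub> y"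
      using G.conjugacy_class_conjugate mem by blast
    then obtain g where g: "g \<in> carrier ?C"
      and "q g \<otimes>\<^bsub>G\<^esub> q (normal_series r \<alpha> \<beta>) = q (normal_series r' \<alpha>' \<beta>') \<otimes>\<^bsub>G\<^esub> q g"
      unfolding carrier_G f_q by blast
    then have eq: "(g oo normal_series r \<alpha> \<beta>) $ n = (normal_series r' \<alpha>' \<beta>' oo g) $ n"
      if "n < p + 3" for n
      using q_conj[OF normal_series_carrier normal_series_carrier g] r that by blast
    have lead: "r = r' \<and> \<alpha> = \<alpha>'" using normal_series_conj_leading[OF g eq r \<alpha>] .
    moreover have "\<beta> = \<beta>'" if "2 * r \<le> p + 1"
      using normal_series_conj_second[OF assms(2) g _ r(1) that \<alpha>(1)] eq lead by blast
    ultimately show ?thesis by blast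
  qed

  \<comment> \<open>Here \<open>2 * r + 1 >= p + 3\<close>, so the \<beta>-term is discarded and
    even the cosets coincide.\<close>
  have "f r \<alpha> \<beta> = f r \<alpha> \<beta>'" if "1 \<le> r" "p + 1 < 2 * r" for r \<alpha> \<beta> \<beta>'
    unfolding f_q using that by (subst q_eq) (auto simp: normal_series_carrier normal_series_nth)
  then have independent: "conjugacy_class G (f r \<alpha> \<beta>) = conjugacy_class G (f r \<alpha> \<beta>')"
    if "1 \<le> r" "\<not> 2 * r \<le> p + 1" for r \<alpha> \<beta> \<beta>'
    using that by (metis not_le)

  show ?thesis
    unfolding not_le[symmetric] half
  proof (intro conjI allI impI ballI; (elim conjE)?)
    fix r r' \<alpha> \<alpha>' \<beta> \<beta>' C
    assume *: "C \<in> conjugacy_classes G" "1 \<le> r" "r \<le> p + 1" "1 \<le> r'" "r' \<le> p + 1"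
      "\<alpha> \<noteq> 0" "\<alpha>' \<noteq> 0" "f r \<alpha> \<beta> \<in> C" "f r' \<alpha>' \<beta>' \<in> C"
    show "r = r'" "\<alpha> = \<alpha>'" using unique[OF *] by simp_all
    show "\<beta> = \<beta>'" if "2 * r \<le> p + 1" using unique[OF *] that by simp
  qed (rule exists[rule_format] nontrivial independent; assumption)+
qed

end
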